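(* Let $k$ be a Sierpiński number constructed using the covering system method, i.e. $k$ is an odd positive integer for which there exist a covering system $\{r_j\pmod{m_j}:1\le j\le\tau\}$ and distinct primes $p_1,\dots,p_\tau$ with $p_j\mid 2^{m_j}-1$, such that $k\equiv -2^{-r_j}\pmod{p_j}$ and $k\cdot 2^n+1>p_j$ for all $1\le j\le\tau$ and all positive integers $n$. Then for every integer $b\ge2$ there exist infinitely many positive integers $t$ such that the $b$-repinteger $k_b^{(t)}$ is a Sierpiński number.
   Context: A covering system of the integers is a finite collection of congruences $r_j \pmod{m_j}$ such that every integer satisfies at least one of them. $2^{-r}\pmod p$ denotes the inverse of $2^r$ modulo the odd prime $p$. A Sierpiński number is an odd positive integer $k$ such that $k\cdot 2^n+1$ is composite for all positive integers $n$. For integers $b\ge2$, $k\ge1$, $t\ge1$, the $b$-repinteger is $k_b^{(t)}=k\,(b^{\ell t}-1)/(b^\ell-1)$ where $\ell=\lfloor\log_b k\rfloor+1$ is the number of base-$b$ digits of $k$ (i.e. the base-$b$ representation of $k$ written $t$ times in a row). *)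

theory Defs
  imports Complex_Main "HOL-Number_Theory.Number_Theory"
begin

definition covering_system :: "nat \<Rightarrow> (nat \<Rightarrow> int) \<Rightarrow> (nat \<Rightarrow> nat) \<Rightarrow> bool" where
  "covering_system \<tau> r m \<longleftrightarrow>
     (\<forall>j\<in>{1..\<tau>}. 0 < m j) \<and> (\<forall>x::int. \<exists>j\<in>{1..\<tau>}. [x = r j] (mod int (m j)))"

text \<open>
  A representative of \<open>2\<^sup>-\<^sup>r\<close> modulo an odd prime \<open>p\<close>. For \<open>0 \<le> r\<close> it is the inverse of
  \<open>2\<^sup>r\<close>; for negative \<open>r\<close> it is the ordinary power with exponent \<open>-r\<close>.
\<close>
definition two_pow_neg_mod :: "int \<Rightarrow> nat \<Rightarrow> int" where
  "two_pow_neg_mod r p =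
     (if 0 \<le> r then modular_inverse (int p) (2 ^ nat r) else 2 ^ nat (- r))"

definition composite :: "nat \<Rightarrow> bool" where
  "composite n \<longleftrightarrow> 1 < n \<and> \<not> prime n"

definition sierpinski :: "nat \<Rightarrow> bool" where
  "sierpinski k \<longleftrightarrow> odd k \<and> 0 < k \<and> (\<forall>n\<ge>1. composite (k * 2 ^ n + 1))"

definition sierpinski_by_covering :: "nat \<Rightarrow> bool" where
  "sierpinski_by_covering k \<longleftrightarrow> odd k \<and> 0 < k \<and>
     (\<exists>\<tau> r m p. covering_system \<tau> r m \<and>
        inj_on p {1..\<tau>} \<and>
        (\<forall>j\<in>{1..\<tau>}. prime (p j) \<and> int (p j) dvd 2 ^ m j - 1 \<and>
           [int k = - two_pow_neg_mod (r j) (p j)] (mod int (p j)) \<and>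
           (\<forall>n\<ge>1. p j < k * 2 ^ n + 1)))"

definition num_digits :: "nat \<Rightarrow> nat \<Rightarrow> nat" where
  "num_digits b k = nat (\<lfloor>log (real b) (real k)\<rfloor> + 1)"

definition repinteger :: "nat \<Rightarrow> nat \<Rightarrow> nat \<Rightarrow> nat" where
  "repinteger b k t =
     k * (b ^ (num_digits b k * t) - 1) div (b ^ num_digits b k - 1)"

text \<open>The natural-number division in \<open>repinteger\<close> is exact.\<close>

lemma repinteger_real:
  assumes "2 \<le> b" "1 \<le> k"
  shows "real (repinteger b k t) =
    real k * (real b ^ (num_digits b k * t) - 1) / (real b ^ num_digits b k - 1)"
proof -
  define l where "l = num_digits b k"
  have "(b ^ l) ^ t - 1 = (b ^ l - 1) * (\<Sum>i<t. (b ^ l) ^ i)"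
  proof -
    have "int ((b ^ l) ^ t - 1) = int ((b ^ l - 1) * (\<Sum>i<t. (b ^ l) ^ i))"
      using assms power_diff_1_eq[of "int b ^ l" t] by (simp add: of_nat_diff)
    then show ?thesis by linarith
  qed
  then have "(b ^ l - 1) dvd k * (b ^ (l * t) - 1)"
    by (simp add: power_mult)
  then show ?thesis
    using assms unfolding repinteger_def l_def[symmetric]
    by (simp add: real_of_nat_div of_nat_diff)
qed

end

theory Submission
  imports Defs
begin

text \<open>
  With \<open>B = b\<^sup>l\<close>, the repinteger is \<open>k \<cdot> (1 + B \<cdot> S)\<close> where \<open>S = 1 + B + \<dots> + B\<^bsup>t-2\<^esup>\<close>. If
  \<open>t - 1\<close> is divisible by \<open>q (q - 1)\<close> for \<open>q = 2\<close> and for every covering prime \<open>q\<close>, then each such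
  \<open>q\<close> divides \<open>B \<cdot> S\<close>. So the repinteger is odd and congruent to \<open>k\<close> modulo every covering
  prime, and it inherits the covering argument of \<open>k\<close>.
\<close>

text \<open>Unless \<open>q\<close> divides \<open>B\<close>, there are two cases. If
  \<open>B\<close> is 1 modulo \<open>q\<close>, the sum is \<open>n\<close> modulo
  \<open>q\<close>, and the factor \<open>q\<close> of \<open>n\<close> kills it. Otherwise the
  factor \<open>q - 1\<close> gives \<open>B ^ n = 1\<close> modulo \<open>q\<close> by Fermat, and
  the factor \<open>B - 1\<close> can be cancelled.\<close>

lemma prime_dvd_mult_geometric_sum:
  fixes B :: nat
  assumes "prime q" and "q * (q - 1) dvd n"
  shows "q dvd B * (\<Sum>i<n. B ^ i)"
proof (cases "q dvd B")
  case not_dvd: False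
  show ?thesis
  proof (cases "[B = 1] (mod q)")
    case True
    then have "[(\<Sum>i<n. B ^ i) = (\<Sum>i<n. 1 ^ i)] (mod q)"
      by (intro cong_sum cong_pow)
    moreover have "q dvd (\<Sum>i<n. 1 ^ i)"
      using dvd_mult_left[OF assms(2)] by simp
    ultimately show ?thesis
      by (metis cong_dvd_iff dvd_mult)
  next
    case False
    obtain c where "n = (q - 1) * c"
      using dvd_mult_right[OF assms(2)] by blast
    then have "[B ^ n = 1] (mod q)"
      using cong_pow[OF fermat_theorem[OF assms(1) not_dvd], of c] by (simp add: power_mult)
    then have "[int B ^ n = 1] (mod int q)"
      by (simp flip: cong_int_iff)
    then have "int q dvd (int B - 1) * (\<Sum>i<n. int B ^ i)"
      by (simp add: cong_iff_dvd_diff power_diff_1_eq)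
    moreover have "\<not> int q dvd int B - 1"
      using False by (simp add: cong_iff_dvd_diff flip: cong_int_iff)
    ultimately have "int q dvd int (\<Sum>i<n. B ^ i)"
      using assms(1) by (simp add: prime_dvd_mult_iff)
    then show ?thesis
      by (simp only: int_dvd_int_iff dvd_mult)
  qed
qed simp

lemma num_digits_pos:
  assumes "2 \<le> b" and "1 \<le> k"
  shows "0 < num_digits b k"
proof -
  have "0 \<le> log (real b) (real k)"
    using assms by simp
  then show ?thesis
    unfolding num_digits_def by linarith
qed

lemma repinteger_eq_sum:
  assumes "2 \<le> b" and "1 \<le> k"
  shows "repinteger b k t = k * (\<Sum>i<t. (b ^ num_digits b k) ^ i)"
proof -
  \<comment> \<open>Strictness keeps the denominator of the geometric sum nonzero.\<close>
  have "1 < real b ^ num_digits b k"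
    using assms(1) num_digits_pos[OF assms] by (intro one_less_power) auto
  then have "real (repinteger b k t) = real (k * (\<Sum>i<t. (b ^ num_digits b k) ^ i))"
    by (simp add: repinteger_real[OF assms] power_mult geometric_sum)
  then show ?thesis
    by linarith
qed

lemma repinteger_Suc_cong:
  assumes "2 \<le> b" and "1 \<le> k" and "prime q" and "q * (q - 1) dvd n"
  shows "[repinteger b k (Suc n) = k] (mod q)"
proof -
  define B where "B = b ^ num_digits b k"
  have "repinteger b k (Suc n) = k * (\<Sum>i<Suc n. B ^ i)"
    by (simp add: repinteger_eq_sum[OF assms(1,2)] B_def del: sum.lessThan_Suc)
  also have "\<dots> = k + k * (B * (\<Sum>i<n. B ^ i))"
    by (simp add: sum.lessThan_Suc_shift sum_distrib_left algebra_simps del: sum.lessThan_Suc)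
  finally show ?thesis
    using prime_dvd_mult_geometric_sum[OF assms(3,4), of B]
    by (simp add: cong_add_lcancel_0_nat cong_0_iff)
qed

text \<open>Carries the bound \<open>p j < k * 2 ^ n + 1\<close> over to the repinteger, so that a
  covering prime is a proper divisor.\<close>

lemma le_repinteger_Suc:
  assumes "2 \<le> b" and "1 \<le> k"
  shows "k \<le> repinteger b k (Suc n)"
  by (simp add: repinteger_eq_sum[OF assms] sum.lessThan_Suc_shift del: sum.lessThan_Suc)

text \<open>The order of 2 modulo \<open>p\<close> divides \<open>m\<close>, so \<open>2 ^ n\<close>
  depends only on \<open>n\<close> modulo \<open>m\<close> and may be replaced by
  \<open>2 ^ r\<close>, read modulo \<open>p\<close>.\<close>

lemma two_power_mult_two_pow_neg_mod:
  assumes "int p dvd 2 ^ m - 1" and "0 < m" and "[int n = r] (mod int m)"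
  shows "[2 ^ n * two_pow_neg_mod r p = 1] (mod int p)"
proof -
  have one: "[2 ^ m = 1] (mod int p)"
    using assms(1) by (simp add: cong_iff_dvd_diff)
  have period: "[2 ^ i = 2 ^ j] (mod int p)" if "[i = j] (mod m)" for i j
  proof -
    have "[2 ^ i = 2 ^ (i mod m)] (mod int p)" for i
    proof -
      have "(2::int) ^ i = (2 ^ m) ^ (i div m) * 2 ^ (i mod m)"
        by (simp flip: power_mult power_add)
      then show ?thesis
        using cong_mult[OF cong_pow[OF one, of "i div m"] cong_refl[of "2 ^ (i mod m)"]] by simp
    qed
    with that show ?thesis
      by (metis cong_def)
  qed
  show ?thesis
  proof (cases "0 \<le> r")
    case True
    \<comment> \<open>A power of 2 that is 1 modulo \<open>p\<close> is a unit there; since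
      \<open>0 < m\<close>, so is 2 itself.\<close>
    have "coprime (2 ^ m) (int p)"
      using one by (metis cong_imp_coprime cong_sym coprime_1_left)
    then have "coprime (2 ^ nat r) (int p)"
      using assms(2) by simp
    then have "[2 ^ nat r * modular_inverse (int p) (2 ^ nat r) = 1] (mod int p)"
      by (rule cong_modular_inverse1)
    moreover have "[n = nat r] (mod m)"
      using assms(3) True by (simp flip: cong_int_iff)
    ultimately show ?thesis
      using True cong_trans[OF cong_scalar_right[OF period]] by (simp add: two_pow_neg_mod_def)
  next
    case False
    \<comment> \<open>For negative \<open>r\<close> the representative is a true power of 2, so the
      exponents just add up to a multiple of \<open>m\<close>.\<close>
    then have "[n + nat (- r) = 0] (mod m)"
      using assms(3) by (simp add: cong_iff_dvd_diff flip: cong_int_iff)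
    with False show ?thesis
      using period[of "n + nat (- r)" 0] by (simp add: two_pow_neg_mod_def power_add)
  qed
qed

theorem theorem3p3:
  fixes k b :: nat
  assumes "sierpinski_by_covering k"
    and "2 \<le> b"
  shows "infinite {t::nat. 1 \<le> t \<and> sierpinski (repinteger b k t)}"
proof -
  obtain \<tau> r m p where k: "odd k" "1 \<le> k" and cov: "covering_system \<tau> r m"
    and all: "\<forall>j\<in>{1..\<tau>}. prime (p j) \<and> int (p j) dvd 2 ^ m j - 1 \<and>
      [int k = - two_pow_neg_mod (r j) (p j)] (mod int (p j)) \<and> (\<forall>n\<ge>1. p j < k * 2 ^ n + 1)"
    using assms(1) unfolding sierpinski_by_covering_def 
    by (elim conjE exE) (rule that, assumption, simp, assumption+)
  have p: "prime (p j)" "int (p j) dvd 2 ^ m j - 1"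
    "[int k = - two_pow_neg_mod (r j) (p j)] (mod int (p j))"
    "1 \<le> n \<Longrightarrow> p j < k * 2 ^ n + 1" if "j \<in> {1..\<tau>}" for j n
    using all that by blast+
  \<comment> \<open>The prime 2 is added to control the parity of the repinteger.\<close>
  define Q where "Q = insert 2 (p ` {1..\<tau>})"
  define P where "P = (\<Prod>q\<in>Q. q * (q - 1))"
  have primes: "prime q" if "q \<in> Q" for q
    using that p(1) by (auto simp: Q_def)
  have cong: "[repinteger b k (Suc (P * s)) = k] (mod q)" if "q \<in> Q" for q s
  proof (rule repinteger_Suc_cong[OF assms(2) k(2) primes[OF that]])
    show "q * (q - 1) dvd P * s"
      using that unfolding P_def by (intro dvd_mult2 dvd_prodI) (auto simp: Q_def)
  qed
  have sierp: "sierpinski (repinteger b k (Suc (P * s)))" for s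
  proof -
    define R where "R = repinteger b k (Suc (P * s))"
    have "k \<le> R"
      unfolding R_def by (rule le_repinteger_Suc[OF assms(2) k(2)])
    have "[R = k] (mod 2)"
      using cong[of 2 s] by (simp add: Q_def R_def)
    with k(1) have "odd R"
      by (simp add: cong_dvd_iff)
    have "composite (R * 2 ^ n + 1)" if "1 \<le> n" for n
    proof -
      \<comment> \<open>The class containing \<open>n\<close> selects the prime that will divide
        \<open>R * 2 ^ n + 1\<close>.\<close>
      obtain j where j: "j \<in> {1..\<tau>}" "[int n = r j] (mod int (m j))" "0 < m j"
        using cov unfolding covering_system_def by blast
      have "[int R = - two_pow_neg_mod (r j) (p j)] (mod int (p j))"
        using cong[of "p j" s] p(3)[OF j(1)] j(1) unfolding R_def Q_def
        by (metis cong_int_iff cong_trans imageI insertI2)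
      then have "[2 ^ n * int R = - (2 ^ n * two_pow_neg_mod (r j) (p j))] (mod int (p j))"
        using cong_scalar_left by fastforce
      also have "[- (2 ^ n * two_pow_neg_mod (r j) (p j)) = - 1] (mod int (p j))"
        using two_power_mult_two_pow_neg_mod[OF p(2)[OF j(1)] j(3,2)]
        by (simp only: cong_minus_minus_iff)
      finally have "int (p j) dvd int (R * 2 ^ n + 1)"
        by (simp add: cong_iff_dvd_diff algebra_simps)
      then have "p j dvd R * 2 ^ n + 1"
        by (simp only: int_dvd_int_iff)
      moreover have "p j < R * 2 ^ n + 1"
        using p(4)[OF j(1) that] \<open>k \<le> R\<close> by (meson add_le_mono1 mult_le_mono1 order_less_le_trans)
      moreover have "1 < p j"
        using p(1)[OF j(1)] by (rule prime_gt_1_nat)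
      ultimately show ?thesis
        unfolding composite_def using prime_nat_iff by (metis less_trans nat_neq_iff)
    qed
    with \<open>odd R\<close> show ?thesis
      unfolding sierpinski_def R_def[symmetric] by (auto simp: odd_pos)
  qed
  \<comment> \<open>Positivity makes distinct \<open>s\<close> give distinct
    \<open>t = Suc (P * s)\<close>.\<close>
  have "0 < P"
    unfolding P_def by (intro prod_pos) (simp add: primes prime_gt_0_nat prime_gt_Suc_0_nat)
  then have "inj (\<lambda>s. Suc (P * s))"
    by (auto simp: inj_on_def)
  then have "infinite (range (\<lambda>s. Suc (P * s)))"
    by (simp add: finite_image_iff)
  then show ?thesis
    by (rule infinite_super[rotated]) (use sierp in auto)
qed

end
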